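(* Let $(S,h)$ be a convex geometry, $\Gamma$ an (additively written) abelian group, and $f:2^S\rightarrow\Gamma$ a mapping such that for every subset $A$ of $S$ that is $h$-closed but not $h$-free, $$\sum_{I:\,A_0\subseteq I\subseteq A} f(I)=0,$$ where $A_0$ denotes the unique $h$-basis of $A$. Then $$\sum_{A\subseteq S} f(A)=\sum_{\substack{A\subseteq S\\ A\ h\text{-free}}} f(A).$$
   Context: $2^S$ denotes the power set of $S$. A closure system $(S,h)$ consists of a set $S$ and a hull operator $h$ on $S$, i.e. a map $h:2^S\to 2^S$ that is extensive ($A\subseteq h(A)$), increasing ($A\subseteq B\Rightarrow h(A)\subseteq h(B)$) and idempotent ($h(h(A))=h(A)$). A subset $A$ of $S$ is called $h$-closed if $h(A)=A$, and $h$-free if all subsets of $A$ (including $A$ itself) are $h$-closed. An $h$-basis of $A$ is an inclusion-minimal subset $B$ of $A$ such that $h(B)=A$. A convex geometry is a closure system $(S,h)$ where $S$ is finite and every $h$-closed subset of $S$ has a unique $h$-basis. *)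

theory Defs
  imports Main "HOL-Library.FuncSet"
begin

text \<open>
  The ground set is a carrier set \<open>S\<close>; the values of \<open>h\<close> outside \<open>Pow S\<close> are irrelevant.
\<close>

definition hull_operator :: "'a set \<Rightarrow> ('a set \<Rightarrow> 'a set) \<Rightarrow> bool" where
  "hull_operator S h \<longleftrightarrow>
     h \<in> Pow S \<rightarrow> Pow S \<and>
     (\<forall>A. A \<subseteq> S \<longrightarrow> A \<subseteq> h A) \<and>
     (\<forall>A B. A \<subseteq> B \<longrightarrow> B \<subseteq> S \<longrightarrow> h A \<subseteq> h B) \<and>
     (\<forall>A. A \<subseteq> S \<longrightarrow> h (h A) = h A)"

definition hull_closed :: "'a set \<Rightarrow> ('a set \<Rightarrow> 'a set) \<Rightarrow> 'a set \<Rightarrow> bool" where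
  "hull_closed S h A \<longleftrightarrow> A \<subseteq> S \<and> h A = A"

definition hull_free :: "'a set \<Rightarrow> ('a set \<Rightarrow> 'a set) \<Rightarrow> 'a set \<Rightarrow> bool" where
  "hull_free S h A \<longleftrightarrow> A \<subseteq> S \<and> (\<forall>B. B \<subseteq> A \<longrightarrow> hull_closed S h B)"

definition is_hull_basis :: "('a set \<Rightarrow> 'a set) \<Rightarrow> 'a set \<Rightarrow> 'a set \<Rightarrow> bool" where
  "is_hull_basis h A B \<longleftrightarrow>
     B \<subseteq> A \<and> h B = A \<and> (\<forall>C. C \<subseteq> A \<and> h C = A \<longrightarrow> \<not> C \<subset> B)"

definition convex_geometry :: "'a set \<Rightarrow> ('a set \<Rightarrow> 'a set) \<Rightarrow> bool" where
  "convex_geometry S h \<longleftrightarrow>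
     finite S \<and> hull_operator S h \<and>
     (\<forall>A. hull_closed S h A \<longrightarrow> (\<exists>!B. is_hull_basis h A B))"

text \<open>Only meaningful when the basis is unique, as for the closed sets of a convex geometry.\<close>

definition hull_basis :: "('a set \<Rightarrow> 'a set) \<Rightarrow> 'a set \<Rightarrow> 'a set" where
  "hull_basis h A = (THE B. is_hull_basis h A B)"

end

theory Submission
  imports Defs
begin

text \<open>
  Sorting the subsets of \<^term>\<open>S\<close> by their hull partitions \<^term>\<open>Pow S\<close> into one fibre
  \<open>{I. I \<subseteq> S \<and> h I = A}\<close> for each closed set \<open>A\<close>. In a convex geometry such a fibre is exactly the
  interval between the basis of \<open>A\<close> and \<open>A\<close> (\<open>hull_fibre_eq_interval\<close>): by finiteness each
  generating set of \<open>A\<close> contains a minimal one, and by uniqueness that one is always the same.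
  The hypothesis on \<open>f\<close> therefore says that the fibres over the non-free closed sets sum to zero.
  Over a free set the fibre is a single point (\<open>hull_fibre_free\<close>), since all subsets of a free
  set are their own hulls; it contributes just \<open>f A\<close>.
\<close>

lemma hull_free_imp_closed: "hull_free S h A \<Longrightarrow> hull_closed S h A"
  by (simp add: hull_free_def)

lemma hull_basis_is_basis:
  assumes "convex_geometry S h" and "hull_closed S h A"
  shows "is_hull_basis h A (hull_basis h A)"
  unfolding hull_basis_def by (rule theI') (use assms in \<open>simp add: convex_geometry_def\<close>)

text \<open>
  A minimal generating subset of \<open>I\<close> is also minimal among all generating subsets of \<open>A\<close>,
  because any competitor below it lies in \<open>I\<close> as well.
\<close>

lemma hull_basis_exists_below:
  assumes "finite I" and "I \<subseteq> A" and "h I = A"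
  obtains B where "is_hull_basis h A B" and "B \<subseteq> I"
proof -
  let ?gen = "{B. B \<subseteq> I \<and> h B = A}"
  have "finite ?gen" and "I \<in> ?gen"
    using assms(1,3) by simp_all
  from finite_has_minimal2 [OF this] obtain B where "B \<in> ?gen"
    and min: "\<forall>C\<in>?gen. C \<subseteq> B \<longrightarrow> B = C"
    by (elim bexE conjE)
  then have B: "B \<subseteq> I" "h B = A"
    by simp_all
  have "is_hull_basis h A B"
    unfolding is_hull_basis_def
  proof (intro conjI allI impI)
    show "B \<subseteq> A" using B(1) assms(2) by (rule subset_trans)
    show "h B = A" by (rule B(2))
    fix C assume C: "C \<subseteq> A \<and> h C = A"
    show "\<not> C \<subset> B"
    proof
      assume "C \<subset> B"
      then have "C \<subseteq> B" and "B \<noteq> C" by auto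
      moreover from \<open>C \<subseteq> B\<close> have "C \<in> ?gen" using B(1) C by simp
      ultimately show False using min by simp
    qed
  qed
  from this B(1) show thesis by (rule that)
qed

text \<open>
  For \<open>I\<close> in the interval, monotonicity squeezes \<open>h I\<close> between the hull of the basis and the hull
  of \<open>A\<close>, which are both \<open>A\<close>. The converse is where uniqueness of bases enters: some basis of \<open>A\<close>
  lies inside each \<open>I\<close> with hull \<open>A\<close>, and there is only one it can be.
\<close>

lemma hull_fibre_eq_interval:
  assumes cg: "convex_geometry S h" and A: "hull_closed S h A"
  shows "{I. I \<subseteq> S \<and> h I = A} = {I. hull_basis h A \<subseteq> I \<and> I \<subseteq> A}"
proof (rule set_eqI)
  fix I
  have AS: "A \<subseteq> S" and hA: "h A = A"
    using A by (simp_all add: hull_closed_def)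
  have mono: "X \<subseteq> Y \<Longrightarrow> Y \<subseteq> S \<Longrightarrow> h X \<subseteq> h Y" for X Y
    using cg by (simp add: convex_geometry_def hull_operator_def)
  have ext: "X \<subseteq> S \<Longrightarrow> X \<subseteq> h X" for X
    using cg by (simp add: convex_geometry_def hull_operator_def)
  have basis: "is_hull_basis h A (hull_basis h A)"
    by (rule hull_basis_is_basis [OF cg A])
  have unique: "\<exists>!B. is_hull_basis h A B"
    using cg A by (simp add: convex_geometry_def)
  have "hull_basis h A \<subseteq> I \<and> I \<subseteq> A" if I: "I \<subseteq> S" "h I = A"
  proof -
    have fin: "finite I"
      using cg finite_subset [OF I(1)] by (simp add: convex_geometry_def)
    have sub: "I \<subseteq> A"
      using ext [OF I(1)] I(2) by simp
    obtain B where B: "is_hull_basis h A B" "B \<subseteq> I"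
      by (rule hull_basis_exists_below [of I A h, OF fin sub I(2)])
    have "hull_basis h A = B"
      unfolding hull_basis_def by (rule the1_equality [OF unique B(1)])
    with B(2) sub show ?thesis by simp
  qed
  moreover have "I \<subseteq> S \<and> h I = A" if I: "hull_basis h A \<subseteq> I" "I \<subseteq> A"
  proof
    show IS: "I \<subseteq> S"
      using I(2) AS by (rule subset_trans)
    have "h (hull_basis h A) = A"
      using basis by (simp add: is_hull_basis_def)
    then show "h I = A"
      using mono [OF I(1) IS] mono [OF I(2) AS] hA by simp
  qed
  ultimately show "I \<in> {I. I \<subseteq> S \<and> h I = A} \<longleftrightarrow> I \<in> {I. hull_basis h A \<subseteq> I \<and> I \<subseteq> A}"
    by blast
qed

lemma hull_fibre_free:
  assumes "hull_operator S h" and free: "hull_free S h A"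
  shows "{I. I \<subseteq> S \<and> h I = A} = {A}"
proof -
  have ext: "X \<subseteq> S \<Longrightarrow> X \<subseteq> h X" for X
    using assms(1) by (simp add: hull_operator_def)
  have "I = A" if "I \<subseteq> S" "h I = A" for I
  proof -
    have "I \<subseteq> A"
      using ext [OF that(1)] that(2) by simp
    then have "h I = I"
      using free by (simp add: hull_free_def hull_closed_def)
    with that show ?thesis by simp
  qed
  then show ?thesis
    using hull_free_imp_closed [OF free] by (auto simp: hull_closed_def)
qed

theorem theorem2:
  fixes S :: "'a set"
    and h :: "'a set \<Rightarrow> 'a set"
    and f :: "'a set \<Rightarrow> 'g::ab_group_add"
  assumes "convex_geometry S h"
    and "\<And>A. A \<subseteq> S \<Longrightarrow> hull_closed S h A \<Longrightarrow> \<not> hull_free S h A \<Longrightarrow>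
           (\<Sum>I\<in>{I. hull_basis h A \<subseteq> I \<and> I \<subseteq> A}. f I) = 0"
  shows "(\<Sum>A\<in>Pow S. f A) = (\<Sum>A\<in>{A. A \<subseteq> S \<and> hull_free S h A}. f A)"
proof -
  let ?closed = "{A. hull_closed S h A}" and ?free = "{A. A \<subseteq> S \<and> hull_free S h A}"
  let ?fibre = "\<lambda>A. {I. I \<subseteq> S \<and> h I = A}"
  have op: "hull_operator S h" and fin: "finite S"
    using assms(1) by (simp_all add: convex_geometry_def)
  have "?closed \<subseteq> Pow S"
    by (auto simp: hull_closed_def)
  then have fin_closed: "finite ?closed"
    using fin finite_subset by blast
  have "h ` Pow S \<subseteq> ?closed"
    using op by (auto simp: hull_operator_def hull_closed_def Pi_def)
  then have "(\<Sum>A\<in>Pow S. f A) = (\<Sum>A\<in>?closed. \<Sum>I\<in>?fibre A. f I)"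
    using sum.group [of "Pow S" ?closed h f] fin fin_closed by simp
  also have "\<dots> = (\<Sum>A\<in>?free. \<Sum>I\<in>?fibre A. f I)"
  proof (rule sum.mono_neutral_right [OF fin_closed])
    show "?free \<subseteq> ?closed"
      using hull_free_imp_closed by blast
    show "\<forall>A\<in>?closed - ?free. (\<Sum>I\<in>?fibre A. f I) = 0"
    proof
      fix A assume "A \<in> ?closed - ?free"
      then have A: "hull_closed S h A" "A \<subseteq> S" "\<not> hull_free S h A"
        by (auto simp: hull_closed_def)
      show "(\<Sum>I\<in>?fibre A. f I) = 0"
        unfolding hull_fibre_eq_interval [OF assms(1) A(1)] by (rule assms(2) [OF A(2,1,3)])
    qed
  qed
  also have "\<dots> = (\<Sum>A\<in>?free. f A)"
    by (rule sum.cong) (simp_all add: hull_fibre_free [OF op])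
  finally show ?thesis .
qed

end
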